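(* With $\delta(c)$ as defined in the context, as $c\to\infty$ we have $\delta(c)=\Omega(c^{1.05})$ and $\delta(c)=O(c^{1.59})$.
   Context: For integers $\ell,c\ge 1$ let $W(\ell,c)$ be the set of sequences $\alpha=(\alpha_1,\dots,\alpha_d)$ of length $d=\ell+c-2$ with entries in $\{1,2\}$ having exactly $\ell-1$ entries equal to $1$ and $c-1$ entries equal to $2$. For $0\le i\le d$ and $s\in\{1,2\}$ let $\nu_{i,s}:=1+|\{1\le j\le i:\alpha_j=s\}|$. Define integers recursively: $x_{1,0}:=x_{2,0}:=0$, and for $i=0,1,\dots,d$ in turn let $k_i:=1+\sum_{s\in\{1,2\}}\min_{j_1,j_2\ge 0,\ j_1+j_2=\nu_{i,s}-1}(x_{s,j_1}+x_{s,j_2})$, and, if $i<d$, set $x_{s,\nu_{i,s}}:=k_i$ for $s=\alpha_{i+1}$. This defines $x_{1,0},\dots,x_{1,\ell-1}$ and $x_{2,0},\dots,x_{2,c-1}$. Put $\beta(\alpha):=1+\min_{j_1,j_2\ge0,\ j_1+j_2=c-1}(x_{2,j_1}+x_{2,j_2})$ and $\delta(\alpha):=\min_{0\le j\le \ell-1}\frac{x_{1,j}+\beta(\alpha)}{j+1}$. Finally $\delta(1):=1$ and, for $c\ge 2$, $\delta(c):=\sup\{\delta(\alpha): \ell\ge 1,\ \alpha\in W(\ell,c),\ \alpha_{\ell+c-2}=2\}$. *)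

theory Defs
  imports Complex_Main "HOL-Library.Extended_Real" "HOL-Library.Landau_Symbols"
begin

text \<open>
  Sequences are 0-indexed lists, so the entry \<open>\<alpha>\<^sub>j\<close> (for \<open>1 \<le> j \<le> d\<close>) is \<open>\<alpha> ! (j - 1)\<close>.
\<close>

definition words :: "nat \<Rightarrow> nat \<Rightarrow> nat list set" where
  "words l c = {\<alpha>. length \<alpha> = l + c - 2 \<and> set \<alpha> \<subseteq> {1, 2} \<and>
                   count_list \<alpha> 1 = l - 1 \<and> count_list \<alpha> 2 = c - 1}"

definition nu :: "nat list \<Rightarrow> nat \<Rightarrow> nat \<Rightarrow> nat" where
  "nu \<alpha> i s = 1 + card {j \<in> {1..i}. \<alpha> ! (j - 1) = s}"

definition min_pair_sum :: "(nat \<Rightarrow> nat) \<Rightarrow> nat \<Rightarrow> nat" where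
  "min_pair_sum f n = Min {f j1 + f j2 | j1 j2. j1 + j2 = n}"

definition next_val :: "nat list \<Rightarrow> nat \<Rightarrow> (nat \<Rightarrow> nat \<Rightarrow> nat) \<Rightarrow> nat" where
  "next_val \<alpha> i x = 1 + (\<Sum>s\<in>{1, 2}. min_pair_sum (x s) (nu \<alpha> i s - 1))"

text \<open>
  \<open>x_table \<alpha> i s j\<close> is \<open>x\<^sub>s\<^sub>,\<^sub>j\<close> as known before round \<open>i\<close>, that is for \<open>j < nu \<alpha> i s\<close>; entries
  not yet assigned hold the dummy value \<open>0\<close> and are never read by \<open>next_val \<alpha> i\<close>.
  The number \<open>k\<^sub>i\<close> is \<open>next_val \<alpha> i (x_table \<alpha> i)\<close>.
\<close>

primrec x_table :: "nat list \<Rightarrow> nat \<Rightarrow> nat \<Rightarrow> nat \<Rightarrow> nat" where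
  "x_table \<alpha> 0 = (\<lambda>s j. 0)"
| "x_table \<alpha> (Suc i) =
     (let x = x_table \<alpha> i; s = \<alpha> ! i
      in x(s := (x s)(nu \<alpha> i s := next_val \<alpha> i x)))"

definition x_final :: "nat list \<Rightarrow> nat \<Rightarrow> nat \<Rightarrow> nat" where
  "x_final \<alpha> = x_table \<alpha> (length \<alpha>)"

definition beta :: "nat \<Rightarrow> nat list \<Rightarrow> nat" where
  "beta c \<alpha> = 1 + min_pair_sum (x_final \<alpha> 2) (c - 1)"

definition delta_word :: "nat \<Rightarrow> nat \<Rightarrow> nat list \<Rightarrow> real" where
  "delta_word l c \<alpha> =
     Min ((\<lambda>j. real (x_final \<alpha> 1 j + beta c \<alpha>) / real (j + 1)) ` {0..l - 1})"

text \<open>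
  The supremum ranges over an infinite set of words. It is taken in the extended reals, where it
  always exists, since the supremum on \<^typ>\<open>real\<close> is unspecified for unbounded sets.
\<close>

definition delta :: "nat \<Rightarrow> ereal" where
  "delta c = (if c = 1 then 1
              else Sup {ereal (delta_word l c \<alpha>) | l \<alpha>. l \<ge> 1 \<and> \<alpha> \<in> words l c \<and> last \<alpha> = 2})"

end

theory Submission
  imports Defs
begin

text \<open>
  Write \<open>a\<close> and \<open>b\<close> for the two sequences of values \<open>x\<^sub>1\<close> and \<open>x\<^sub>2\<close>, and let \<open>\<beta>\<close> be \<open>1\<close> plus the
  minimal pair sum of \<open>b\<close> at a prefix with \<open>q\<close> entries \<open>2\<close>.

  Upper bound: \<open>a\<^sub>n\<^sub>-\<^sub>1 + \<beta>\<close> is subadditive in \<open>n\<close>, and going from \<open>q\<close> to at most \<open>2 q + 2\<close> turns \<open>\<beta>\<close> into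
  at most \<open>2 A + 2 \<beta> + 1\<close>, where \<open>A\<close> is the minimal pair sum of \<open>a\<close> at the prefix. If a witness
  \<open>n\<close> for the minimum defining \<open>\<delta>\<close> is replaced at each step by its largest multiple in range, the
  minimum at most triples, whence \<open>\<delta>(c) \<le> c powr log 2 3\<close>.

  Lower bound: the word \<open>1\<^sup>9 2 1\<^sup>3 2 2\<close> has \<open>c = 4\<close> and \<open>\<delta> = 43 / 10 > 4 powr 1.05\<close>. Simulating it with
  every \<open>2\<close> blown up to \<open>c\<close> entries \<open>2\<close> and every \<open>1\<close> to a long run of entries \<open>1\<close>, on top of a word
  with value \<open>D\<close>, gives words for \<open>4 c\<close> with values arbitrarily close to \<open>43 / 10 * D\<close>.
\<close>

section \<open>Attainment, locality and monotonicity of minimal pair sums\<close>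

lemma min_pair_sum_set:
  fixes f :: "nat \<Rightarrow> nat"
  shows "{f j1 + f j2 | j1 j2. j1 + j2 = n} = (\<lambda>i. f i + f (n - i)) ` {0..n}"
proof (intro equalityI subsetI)
  fix y
  assume "y \<in> {f j1 + f j2 | j1 j2. j1 + j2 = n}"
  then obtain i j where "i + j = n" "y = f i + f j"
    by auto
  then show "y \<in> (\<lambda>i. f i + f (n - i)) ` {0..n}"
    by (intro image_eqI[of _ _ i]) auto
next
  fix y
  assume "y \<in> (\<lambda>i. f i + f (n - i)) ` {0..n}"
  then obtain i where "i \<le> n" "y = f i + f (n - i)"
    by auto
  then show "y \<in> {f j1 + f j2 | j1 j2. j1 + j2 = n}"
    by (intro CollectI exI[of _ i] exI[of _ "n - i"]) auto
qed

lemma min_pair_sum_le: "i + j = n \<Longrightarrow> min_pair_sum f n \<le> f i + f j"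
  unfolding min_pair_sum_def by (rule Min_le) (simp add: min_pair_sum_set, blast)

lemma min_pair_sum_attained:
  obtains i j where "i + j = n" "min_pair_sum f n = f i + f j"
proof -
  have "min_pair_sum f n \<in> {f j1 + f j2 | j1 j2. j1 + j2 = n}"
    unfolding min_pair_sum_def by (rule Min_in) (auto simp: min_pair_sum_set)
  then show ?thesis
    using that by auto
qed

lemma min_pair_sum_cong:
  assumes "\<And>j. j \<le> n \<Longrightarrow> f j = g j"
  shows "min_pair_sum f n = min_pair_sum g n"
proof -
  have "(\<lambda>i. f i + f (n - i)) ` {0..n} = (\<lambda>i. g i + g (n - i)) ` {0..n}"
    by (rule image_cong) (auto simp: assms)
  then show ?thesis
    by (simp add: min_pair_sum_def min_pair_sum_set)
qed

lemma min_pair_sum_0 [simp]: "min_pair_sum f 0 = 2 * f 0"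
  by (simp add: min_pair_sum_def min_pair_sum_set)

lemma min_pair_sum_mono:
  assumes mono: "\<And>i j. i \<le> j \<Longrightarrow> j \<le> n \<Longrightarrow> f i \<le> f j" and "m \<le> n"
  shows "min_pair_sum f m \<le> min_pair_sum f n"
proof -
  obtain i j where ij: "i + j = n" "min_pair_sum f n = f i + f j"
    by (rule min_pair_sum_attained)
  \<comment> \<open>Truncating the first index of an optimal pair for \<open>n\<close> gives a pair
    for \<open>m\<close> whose second index is at most \<open>j\<close>.\<close>
  define i' where "i' = min i m"
  have "min_pair_sum f m \<le> f i' + f (m - i')"
    by (rule min_pair_sum_le) (simp add: i'_def)
  also have "\<dots> \<le> f i + f j"
    using ij(1) \<open>m \<le> n\<close> by (intro add_mono mono) (auto simp: i'_def)
  finally show ?thesis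
    using ij by simp
qed

section \<open>The recursion along prefixes of a word, and monotonicity of its values\<close>

text \<open>This is \<open>k_i\<close> at \<open>i = length \<alpha>\<close>, with counts in place
  of \<open>nu\<close>, so that rounds become prefixes and induction can append letters.\<close>

definition next_value :: "nat list \<Rightarrow> nat" where
  "next_value \<alpha> = 1 + min_pair_sum (x_final \<alpha> 1) (count_list \<alpha> 1)
                    + min_pair_sum (x_final \<alpha> 2) (count_list \<alpha> 2)"

lemma nu_append: "i \<le> length \<alpha> \<Longrightarrow> nu (\<alpha> @ \<beta>) i s = nu \<alpha> i s"
  unfolding nu_def by (intro arg_cong[where f = "\<lambda>A. 1 + card A"]) (auto simp: nth_append)

lemma nu_length: "nu \<alpha> (length \<alpha>) s = Suc (count_list \<alpha> s)"
proof (induction \<alpha> rule: rev_induct)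
  case Nil
  then show ?case by (simp add: nu_def)
next
  case (snoc x \<alpha>)
  have "{j \<in> {1..Suc (length \<alpha>)}. (\<alpha> @ [x]) ! (j - 1) = s} =
        {j \<in> {1..length \<alpha>}. \<alpha> ! (j - 1) = s} \<union> (if x = s then {Suc (length \<alpha>)} else {})"
    by (auto simp: nth_append le_Suc_eq)
  then show ?case
    using snoc by (auto simp: nu_def card_insert_if)
qed

lemma x_table_append: "i \<le> length \<alpha> \<Longrightarrow> x_table (\<alpha> @ \<beta>) i = x_table \<alpha> i"
proof (induction i)
  case (Suc i)
  then show ?case
    by (simp add: nu_append next_val_def nth_append Let_def)
qed simp

lemma x_final_Nil: "x_final [] = (\<lambda>s j. 0)"
  by (simp add: x_final_def)

lemma x_final_snoc:
  "x_final (\<alpha> @ [s]) =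
     (x_final \<alpha>)(s := (x_final \<alpha> s)(Suc (count_list \<alpha> s) := next_value \<alpha>))"
  by (simp add: x_final_def x_table_append nu_append nu_length next_val_def next_value_def Let_def)

text \<open>Each new letter writes only at the index one above the current count, so entries already
  assigned are never overwritten.\<close>

lemma x_final_append:
  "j \<le> count_list \<alpha> s \<Longrightarrow> x_final (\<alpha> @ \<beta>) s j = x_final \<alpha> s j"
proof (induction \<beta> rule: rev_induct)
  case (snoc x \<beta>)
  then show ?case
    using x_final_snoc[of "\<alpha> @ \<beta>" x] by auto
qed simp

lemma x_final_0 [simp]: "x_final \<alpha> s 0 = 0"
  by (induction \<alpha> rule: rev_induct) (auto simp: x_final_Nil x_final_snoc)

lemma min_pair_sum_append:
  "n \<le> count_list \<alpha> s \<Longrightarrow> min_pair_sum (x_final (\<alpha> @ \<beta>) s) n = min_pair_sum (x_final \<alpha> s) n"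
  by (intro min_pair_sum_cong x_final_append) simp

text \<open>The recursion read inside the finished table: the pair sums at the prefix
  \<open>u\<close> involve only entries that the rest of the word leaves unchanged.\<close>

lemma x_final_entry:
  "x_final (u @ s # v) s (Suc (count_list u s)) =
     1 + min_pair_sum (x_final (u @ s # v) 1) (count_list u 1)
       + min_pair_sum (x_final (u @ s # v) 2) (count_list u 2)"
  using x_final_append[of "Suc (count_list u s)" "u @ [s]" s v]
  by (simp add: x_final_snoc min_pair_sum_append next_value_def)

text \<open>The two claims support each other: the bound by \<open>next_value\<close> makes the
  appended entry large enough, and monotone entries make the pair sums, hence
  \<open>next_value\<close>, grow.\<close>

lemma x_final_mono_aux:
  "(\<forall>s\<in>{1, 2}. (\<forall>j < count_list \<alpha> s. x_final \<alpha> s j \<le> x_final \<alpha> s (Suc j)) \<and>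
      x_final \<alpha> s (count_list \<alpha> s) \<le> next_value \<alpha>)"
proof (induction \<alpha> rule: rev_induct)
  case Nil
  then show ?case by (simp add: x_final_Nil)
next
  case (snoc t \<alpha>)
  let ?x = "x_final (\<alpha> @ [t])"
  have steps: "\<forall>j < count_list (\<alpha> @ [t]) s. ?x s j \<le> ?x s (Suc j)" if "s \<in> {1, 2}" for s
    using snoc that by (auto simp: x_final_snoc less_Suc_eq)
  have mono: "?x s i \<le> ?x s j"
    if "s \<in> {1, 2}" "i \<le> j" "j \<le> count_list (\<alpha> @ [t]) s" for s i j
    using that(2,3)
  proof (induction j rule: dec_induct)
    case (step j)
    then show ?case
      using steps[OF that(1)] by (meson Suc_le_lessD le_trans less_imp_le)
  qed simp
  have mps: "min_pair_sum (x_final \<alpha> s) (count_list \<alpha> s)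
      \<le> min_pair_sum (?x s) (count_list (\<alpha> @ [t]) s)" if "s \<in> {1, 2}" for s
  proof -
    have "min_pair_sum (x_final \<alpha> s) (count_list \<alpha> s) = min_pair_sum (?x s) (count_list \<alpha> s)"
      by (simp add: min_pair_sum_append)
    also have "\<dots> \<le> min_pair_sum (?x s) (count_list (\<alpha> @ [t]) s)"
      by (rule min_pair_sum_mono) (use mono that in auto)
    finally show ?thesis .
  qed
  have "next_value \<alpha> \<le> next_value (\<alpha> @ [t])"
    using mps[of 1] mps[of 2] by (simp add: next_value_def)
  moreover have "?x s (count_list (\<alpha> @ [t]) s) \<le> next_value \<alpha>" if "s \<in> {1, 2}" for s
    using snoc that by (auto simp: x_final_snoc)
  ultimately show ?case
    using steps by (meson le_trans)
qed

lemma x_final_mono: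
  assumes "s \<in> {1, 2}" "i \<le> j" "j \<le> count_list \<alpha> s"
  shows "x_final \<alpha> s i \<le> x_final \<alpha> s j"
  using assms(2,3)
proof (induction j rule: dec_induct)
  case (step j)
  then show ?case
    using x_final_mono_aux[of \<alpha>] assms(1) by (meson Suc_le_lessD le_trans less_imp_le)
qed simp

lemma min_pair_sum_x_final_mono:
  assumes "s \<in> {1, 2}" "m \<le> n" "n \<le> count_list \<alpha> s"
  shows "min_pair_sum (x_final \<alpha> s) m \<le> min_pair_sum (x_final \<alpha> s) n"
  using assms by (intro min_pair_sum_mono x_final_mono) auto

lemma split_at_occurrence:
  assumes "n < count_list \<alpha> s"
  obtains u v where "\<alpha> = u @ s # v" "count_list u s = n"
proof -
  have "\<exists>u v. \<alpha> = u @ s # v \<and> count_list u s = n"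
    using assms
  proof (induction \<alpha> rule: rev_induct)
    case (snoc x \<alpha>)
    show ?case
    proof (cases "n < count_list \<alpha> s")
      case True
      then show ?thesis using snoc.IH by fastforce
    next
      case False
      then have "x = s" "count_list \<alpha> s = n"
        using snoc.prems by (auto split: if_splits)
      then show ?thesis by blast
    qed
  qed simp
  then show ?thesis using that by blast
qed

section \<open>The upper bound\<close>

text \<open>
  The first inequality says \<open>\<delta> \<le> T\<close> for \<open>u\<close> itself; the second one says that the same \<open>n\<close> gives the
  bound \<open>3 T\<close> once the number of entries \<open>2\<close> has doubled.
\<close>

definition ratio_bound :: "nat list \<Rightarrow> nat \<Rightarrow> bool" where
  "ratio_bound u T \<longleftrightarrow> (\<exists>n. 1 \<le> n \<and> n \<le> Suc (count_list u 1) \<and>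
     x_final u 1 (n - 1) + 1 + min_pair_sum (x_final u 2) (count_list u 2) \<le> T * n \<and>
     x_final u 1 (n - 1) + 2 * min_pair_sum (x_final u 1) (count_list u 1)
       + 2 * min_pair_sum (x_final u 2) (count_list u 2) + 3 \<le> 3 * T * n)"

text \<open>The entry is created when exactly \<open>i + j\<close> entries \<open>1\<close> are
  present, so \<open>(i, j)\<close> is a candidate pair. In terms of \<open>i + 1\<close> and
  \<open>j + 1\<close> this is the subadditivity behind the upper bound.\<close>

lemma x_final_subadditive:
  assumes "i + j < count_list u 1"
  shows "x_final u 1 (Suc (i + j)) \<le>
    x_final u 1 i + x_final u 1 j + 1 + min_pair_sum (x_final u 2) (count_list u 2)"
proof -
  obtain u1 u2 where u: "u = u1 @ 1 # u2" "count_list u1 1 = i + j"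
    using assms by (rule split_at_occurrence)
  have "x_final u 1 (Suc (i + j)) = 1 + min_pair_sum (x_final u 1) (i + j)
      + min_pair_sum (x_final u 2) (count_list u1 2)"
    using x_final_entry[of u1 1 u2] u by simp
  moreover have "min_pair_sum (x_final u 1) (i + j) \<le> x_final u 1 i + x_final u 1 j"
    by (rule min_pair_sum_le) simp
  moreover have "min_pair_sum (x_final u 2) (count_list u1 2)
      \<le> min_pair_sum (x_final u 2) (count_list u 2)"
    by (rule min_pair_sum_x_final_mono) (auto simp: u)
  ultimately show ?thesis by simp
qed

lemma x_final_multiple:
  assumes "1 \<le> n" "1 \<le> k" "k * n \<le> Suc (count_list u 1)"
  shows "x_final u 1 (k * n - 1) + (1 + min_pair_sum (x_final u 2) (count_list u 2)) \<le>
    k * (x_final u 1 (n - 1) + (1 + min_pair_sum (x_final u 2) (count_list u 2)))"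
  using assms(2,3)
proof (induction k rule: dec_induct)
  case (step k)
  have "1 \<le> k * n"
    using step.hyps assms(1) by simp
  then have "n + k * n - 1 = Suc ((k * n - 1) + (n - 1))"
    using assms(1) by linarith
  moreover have "(k * n - 1) + (n - 1) < count_list u 1"
    using step assms(1) calculation by simp
  ultimately show ?case
    using x_final_subadditive[of "k * n - 1" "n - 1" u] step by simp
qed simp

text \<open>Here the pair sum of the second sequence is 0, so each new entry exceeds the previous
  one by at most 1. The largest possible witness then satisfies both inequalities.\<close>

lemma ratio_bound_no_twos:
  assumes "count_list u 2 = 0" "1 \<le> T"
  shows "ratio_bound u T"
proof -
  have le: "x_final u 1 n \<le> n" if "n \<le> count_list u 1" for n
    using that
  proof (induction n)
    case (Suc n)
    then show ?case
      using x_final_subadditive[of n 0 u] assms(1) by simp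
  qed simp
  let ?N = "count_list u 1"
  have "min_pair_sum (x_final u 1) ?N \<le> x_final u 1 ?N + x_final u 1 0"
    by (rule min_pair_sum_le) simp
  with le[of ?N] have "min_pair_sum (x_final u 1) ?N \<le> ?N" "x_final u 1 ?N \<le> ?N"
    by auto
  moreover have "Suc ?N \<le> T * Suc ?N"
    using mult_le_mono1[OF assms(2), of "Suc ?N"] by simp
  ultimately have "x_final u 1 ?N + 1 \<le> T * Suc ?N"
    "x_final u 1 ?N + 2 * min_pair_sum (x_final u 1) ?N + 3 \<le> 3 * (T * Suc ?N)"
    by linarith+
  then show ?thesis
    unfolding ratio_bound_def mult.assoc using assms(1)
    by (intro exI[of _ "Suc ?N"] conjI) (simp_all del: mult_Suc_right)
qed

text \<open>The second inequality for \<open>u'\<close> yields the first one for \<open>u\<close>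
  with the same \<open>n\<close>. Extra entries \<open>1\<close> in \<open>v\<close> may spoil the
  second one, which is why \<open>n\<close> is replaced by a multiple.\<close>

lemma ratio_bound_step:
  assumes u: "u = u' @ 2 # v" and q: "count_list u 2 \<le> 2 * count_list u' 2 + 2"
    and "ratio_bound u' T"
  shows "ratio_bound u (3 * T)"
proof -
  define A where "A = min_pair_sum (x_final u' 1) (count_list u' 1)"
  define B where "B = min_pair_sum (x_final u' 2) (count_list u' 2)"
  define B' where "B' = min_pair_sum (x_final u 2) (count_list u 2)"
  obtain n where n: "1 \<le> n" "n \<le> Suc (count_list u' 1)"
    and P1: "x_final u' 1 (n - 1) + 1 + B \<le> T * n"
    and P2: "x_final u' 1 (n - 1) + 2 * A + 2 * B + 3 \<le> 3 * T * n"
    using assms(3) unfolding ratio_bound_def A_def B_def by auto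
  define P where "P = x_final u 1 (n - 1)"
  have P: "x_final u' 1 (n - 1) = P"
    using n unfolding P_def u by (subst x_final_append) auto
  \<comment> \<open>With the largest multiple in range, the indices \<open>k * n - 1\<close> and
    \<open>Suc (count_list u 1) - k * n\<close> form a pair for \<open>A'\<close>, and the latter is
    at most \<open>n - 1\<close>.\<close>
  define k where "k = Suc (count_list u 1) div n"
  have "n \<le> Suc (count_list u 1)"
    using n by (simp add: u)
  then have k: "1 \<le> k" "k * n \<le> Suc (count_list u 1)" "Suc (count_list u 1) - k * n < n"
    using n by (auto simp: k_def div_greater_zero_iff Suc_le_eq minus_div_mult_eq_mod)
  define P' where "P' = x_final u 1 (k * n - 1)"
  have kn: "1 \<le> k * n"
    using k n by simp
  have "x_final u 2 (Suc (count_list u' 2)) = 1 + A + B"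
    using x_final_entry[of u' 2 v] unfolding A_def B_def u
    by (simp add: min_pair_sum_append)
  \<comment> \<open>By \<open>q\<close>, the count splits into two indices of size at most
    \<open>Suc (count_list u' 2)\<close>.\<close>
  moreover have "B' \<le> 2 * x_final u 2 (Suc (count_list u' 2))"
  proof -
    have "B' \<le> x_final u 2 (min (Suc (count_list u' 2)) (count_list u 2))
        + x_final u 2 (count_list u 2 - min (Suc (count_list u' 2)) (count_list u 2))"
      unfolding B'_def by (rule min_pair_sum_le) simp
    also have "\<dots> \<le> x_final u 2 (Suc (count_list u' 2)) + x_final u 2 (Suc (count_list u' 2))"
      using q by (intro add_mono x_final_mono) (auto simp: u)
    finally show ?thesis by simp
  qed
  ultimately have X: "P + (1 + B') \<le> 3 * T * n"
    using P2 P by simp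
  have P': "P' + (1 + B') \<le> k * (P + (1 + B'))"
    using x_final_multiple[OF n(1) k(1,2)] unfolding P'_def P_def B'_def .
  have A': "min_pair_sum (x_final u 1) (count_list u 1) \<le> P' + P"
  proof -
    have "min_pair_sum (x_final u 1) (count_list u 1)
        \<le> P' + x_final u 1 (Suc (count_list u 1) - k * n)"
      unfolding P'_def by (rule min_pair_sum_le) (use k kn in simp)
    moreover have "x_final u 1 (Suc (count_list u 1) - k * n) \<le> P"
      unfolding P_def using k n by (intro x_final_mono) (auto simp: u)
    ultimately show ?thesis by simp
  qed
  define X where "X = P + (1 + B')"
  define Y where "Y = 3 * T * n"
  have XY: "X \<le> Y" and PY: "3 * P + 1 \<le> Y"
    using X P1 P unfolding X_def Y_def by auto
  have "k * X \<le> k * Y"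
    using XY by simp
  then have first: "P' + (1 + B') \<le> k * Y"
    using P' unfolding X_def by simp
  obtain m where m: "k = Suc m"
    using k(1) by (cases k) auto
  \<comment> \<open>Here \<open>p\<close> and \<open>p'\<close> stand for \<open>m * X\<close> and
    \<open>m * Y\<close>. What remains is \<open>2 * X + 3 * P + 1 \<le> 3 * Y\<close>, the sum of
    twice \<open>XY\<close> and \<open>PY\<close>.\<close>
  have "3 * (X + p) + 3 * P + 1 \<le> 3 * (Y + p') + X" if "p \<le> p'" for p p'
    using that XY PY by (simp add: algebra_simps)
  from this[OF mult_le_mono2[OF XY, of m]] have "3 * (k * X) + 3 * P + 1 \<le> 3 * (k * Y) + X"
    unfolding m mult_Suc .
  then have second: "3 * P' + 2 * P + 2 * B' + 3 \<le> 3 * (k * Y)"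
    using P' unfolding X_def by simp
  have kY: "3 * T * (k * n) = k * Y" "3 * (3 * T) * (k * n) = 3 * (k * Y)"
    unfolding Y_def by (simp_all only: ac_simps)
  have "P' + 1 + B' \<le> 3 * T * (k * n)"
    unfolding kY using first by linarith
  moreover have "P' + 2 * min_pair_sum (x_final u 1) (count_list u 1) + 2 * B' + 3
      \<le> 3 * (3 * T) * (k * n)"
    unfolding kY using second A' by linarith
  ultimately show ?thesis
    unfolding ratio_bound_def P'_def B'_def
    by (intro exI[of _ "k * n"] conjI kn k(2))
qed

text \<open>The bound \<open>2 ^ Suc i - 2\<close> starts at 0 and is mapped to its successor by
  \<open>q \<mapsto> 2 * q + 2\<close>, the growth allowed in one step.\<close>

lemma ratio_bound_power:
  assumes "count_list u 2 \<le> 2 ^ Suc i - 2"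
  shows "ratio_bound u (3 ^ i)"
  using assms
proof (induction i arbitrary: u)
  case 0
  then show ?case by (simp add: ratio_bound_no_twos)
next
  case (Suc i)
  show ?case
  proof (cases "count_list u 2 = 0")
    case True
    then show ?thesis by (simp add: ratio_bound_no_twos)
  next
    case False
    define q where "q = (count_list u 2 - 1) div 2"
    have "q < count_list u 2"
      using False by (simp add: q_def)
    then obtain u' v where u: "u = u' @ 2 # v" "count_list u' 2 = q"
      by (rule split_at_occurrence)
    have "q \<le> 2 ^ Suc i - 2" "count_list u 2 \<le> 2 * q + 2"
      using Suc.prems by (auto simp: q_def)
    with u Suc.IH[of u'] show ?thesis
      using ratio_bound_step[of u u' v "3 ^ i"] by simp
  qed
qed

lemma delta_word_le:
  assumes "\<alpha> \<in> words l c" "1 \<le> l" "1 \<le> c" "c < 2 ^ Suc i"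
  shows "delta_word l c \<alpha> \<le> 3 ^ i"
proof -
  have cnt: "count_list \<alpha> 1 = l - 1" "count_list \<alpha> 2 = c - 1"
    using assms(1) by (auto simp: words_def)
  then have "ratio_bound \<alpha> (3 ^ i)"
    using assms(3,4) by (intro ratio_bound_power) simp
  then obtain n where n: "1 \<le> n" "n \<le> l" "x_final \<alpha> 1 (n - 1) + beta c \<alpha> \<le> 3 ^ i * n"
    using assms(2) cnt unfolding ratio_bound_def beta_def by auto
  have "delta_word l c \<alpha> \<le> real (x_final \<alpha> 1 (n - 1) + beta c \<alpha>) / real (n - 1 + 1)"
    unfolding delta_word_def using n by (intro Min_le imageI finite_imageI) auto
  also have "\<dots> \<le> 3 ^ i"
    using n(1) of_nat_mono[OF n(3), where ?'a = real] by (simp add: divide_le_eq)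
  finally show ?thesis .
qed

lemma delta_le:
  assumes "1 \<le> c" "c < 2 ^ Suc i"
  shows "delta c \<le> ereal (3 ^ i)"
  using assms delta_word_le[of _ _ c i] unfolding delta_def
  by (auto intro!: Sup_least simp: one_ereal_def)

section \<open>The lower bound\<close>

lemma count_list_replicate: "count_list (replicate n x) y = (if x = y then n else 0)"
  by (induction n) auto

lemma min_pair_sum_ge:
  assumes "\<And>i j. i + j = n \<Longrightarrow> x \<le> real (f i) + real (f j)"
  shows "x \<le> real (min_pair_sum f n)"
  by (rule min_pair_sum_attained[of n f]) (use assms in auto)

text \<open>The entry is created after \<open>pre\<close>, when at least
  \<open>count_list pre t\<close> letters \<open>t\<close> are present, and pair sums are
  monotone.\<close>

lemma x_final_ge:
  assumes "count_list pre s \<le> j" "j < count_list (pre @ post) s"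
    and st: "s = 1 \<and> t = 2 \<or> s = 2 \<and> t = 1"
  shows "1 + min_pair_sum (x_final (pre @ post) s) j
      + min_pair_sum (x_final (pre @ post) t) (count_list pre t) \<le> x_final (pre @ post) s (Suc j)"
proof -
  obtain u v where uv: "pre @ post = u @ s # v" "count_list u s = j"
    using assms(2) by (rule split_at_occurrence)
  from uv(1) obtain u' where "u = pre @ u'"
  proof (cases "length pre \<le> length u")
    case True
    then show ?thesis
      using uv(1) that by (metis append_eq_append_conv_if append_take_drop_id)
  next
    case False
    \<comment> \<open>Otherwise the letter creating the entry lies inside \<open>pre\<close>, which
      would then contain more than \<open>j\<close> letters \<open>s\<close>.\<close>
    then have "pre = u @ s # take (length pre - Suc (length u)) v"
      using arg_cong[OF uv(1), of "take (length pre)"] by (simp add: take_Cons')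
    then have "count_list pre s = count_list u s + Suc (count_list (take (length pre - Suc (length u)) v) s)"
      by (metis count_list.simps(2) count_list_append Suc_eq_plus1)
    then show ?thesis
      using assms(1) uv(2) by simp
  qed
  then have "count_list pre t \<le> count_list u t"
    by simp
  moreover have "count_list u t \<le> count_list (pre @ post) t"
    unfolding uv(1) by simp
  ultimately have "min_pair_sum (x_final (pre @ post) t) (count_list pre t)
      \<le> min_pair_sum (x_final (pre @ post) t) (count_list u t)"
    using st by (intro min_pair_sum_x_final_mono) auto
  with x_final_entry[of u s v] st uv show ?thesis
    by auto
qed

lemma delta_word_mult_le:
  assumes "j < l"
  shows "delta_word l c \<alpha> * real (j + 1) \<le> real (x_final \<alpha> 1 j) + real (beta c \<alpha>)"
proof -
  have "delta_word l c \<alpha> \<le> real (x_final \<alpha> 1 j + beta c \<alpha>) / real (j + 1)"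
    unfolding delta_word_def using assms by (intro Min_le imageI finite_imageI) auto
  then show ?thesis
    by (simp add: le_divide_eq)
qed

lemma delta_word_ge:
  assumes "1 \<le> l" "\<And>j. j < l \<Longrightarrow> r * real (j + 1) \<le> real (x_final \<alpha> 1 j) + real (beta c \<alpha>)"
  shows "r \<le> delta_word l c \<alpha>"
  unfolding delta_word_def using assms by (intro Min.boundedI) (auto simp: le_divide_eq)

lemma delta_word_pos: "0 < delta_word l c \<alpha>"
  unfolding delta_word_def by (subst Min_gr_iff) (auto simp: beta_def)

text \<open>One round of the simulation. The error terms are multiples of \<open>k\<close>, which
  depends on \<open>u\<close> only, so they become negligible against \<open>U\<close> as
  \<open>N\<close> grows.\<close>

lemma delta_word_quadruple:
  assumes u: "u \<in> words l c" and l: "1 \<le> l" and c: "1 \<le> c"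
    and r: "r < 43 / 10 * delta_word l c u"
  shows "\<exists>l' w. 1 \<le> l' \<and> w \<in> words l' (4 * c) \<and> last w = 2 \<and> r \<le> delta_word l' (4 * c) w"
proof -
  define D where "D = delta_word l c u"
  \<comment> \<open>Raising \<open>r\<close> to at least \<open>D\<close> makes
    \<open>r' - D\<close> nonnegative, so \<open>(r' - D) * t\<close> can be bounded at the largest
    \<open>t\<close>.\<close>
  define r' where "r' = max r D"
  have D: "0 < D" "D \<le> r'" "r \<le> r'" "r' < 43 / 10 * D"
    using r delta_word_pos[of l c u] by (auto simp: D_def r'_def)
  define k where "k = real (beta c u)"
  define e where "e = 43 / 10 * D - r'"
  have "0 < e"
    using D by (simp add: e_def)
  obtain N where N: "l \<le> N" "k \<le> real N * e"
  proof -
    obtain n where "k / e < real n"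
      using reals_Archimedean2 by blast
    then have "k \<le> real (max l n) * e"
      using \<open>0 < e\<close> by (simp add: divide_less_eq) (smt (verit) mult_right_mono of_nat_le_iff max.cobounded2 of_nat_max)
    then show ?thesis
      using that[of "max l n"] by simp
  qed
  \<comment> \<open>Index 0 takes no letter. The counts therefore end at \<open>10 * N - 1\<close>
    and \<open>13 * N - 1\<close>, and the blocks of \<open>b\<close> start at \<open>0\<close>,
    \<open>c\<close>, \<open>2 * c\<close> and \<open>3 * c\<close>.\<close>
  define pre1 where "pre1 = u @ replicate (10 * N - l) 1"
  define pre2 where "pre2 = pre1 @ replicate c 2"
  define pre3 where "pre3 = pre2 @ replicate (3 * N) 1"
  define w where "w = pre3 @ replicate (2 * c) (2 :: nat)"
  have cu: "count_list u 1 = l - 1" "count_list u 2 = c - 1"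
    using u by (auto simp: words_def)
  have c1: "count_list pre1 1 = 10 * N - 1" "count_list pre1 2 = c - 1"
    using cu N l by (auto simp: pre1_def count_list_replicate)
  have c2: "count_list pre2 1 = 10 * N - 1" "count_list pre2 2 = 2 * c - 1"
    using c1 c by (auto simp: pre2_def count_list_replicate)
  have c3: "count_list pre3 1 = 13 * N - 1" "count_list pre3 2 = 2 * c - 1"
    using c2 N l by (auto simp: pre3_def count_list_replicate)
  have cw: "count_list w 1 = 13 * N - 1" "count_list w 2 = 4 * c - 1"
    using c3 c by (auto simp: w_def count_list_replicate)
  define a where "a = x_final w 1"
  define b where "b = x_final w 2"
  define U where "U = D * real N"
  have U: "0 \<le> U"
    using D by (simp add: U_def)
  have w_u: "w = u @ replicate (10 * N - l) 1 @ replicate c 2 @ replicate (3 * N) 1 @ replicate (2 * c) 2"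
    and w1: "w = pre1 @ replicate c 2 @ replicate (3 * N) 1 @ replicate (2 * c) 2"
    and w2: "w = pre2 @ replicate (3 * N) 1 @ replicate (2 * c) 2"
    by (simp_all add: w_def pre1_def pre2_def pre3_def)
  have b_mono: "b i \<le> b j" if "i \<le> j" "j < 4 * c" for i j
    using that cw unfolding b_def by (intro x_final_mono) auto

  have k: "k = 1 + real (min_pair_sum b (c - 1))"
    unfolding k_def beta_def b_def w_u using cu by (simp add: min_pair_sum_append)
  \<comment> \<open>For \<open>n < l\<close> this is the definition of \<open>D\<close>. Beyond, a
    pair for \<open>n - 1\<close> loses \<open>2 * k\<close>, and the pair sum of \<open>b\<close>
    with its \<open>1\<close> restores one \<open>k\<close>.\<close>
  have a_lin: "D * real (n + 1) - k \<le> real (a n)" if "n < 13 * N" for n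
    using that
  proof (induction n rule: less_induct)
    case (less n)
    show ?case
    proof (cases "n < l")
      case True
      then have "a n = x_final u 1 n"
        using cu unfolding a_def w_u by (intro x_final_append) auto
      then show ?thesis
        using delta_word_mult_le[OF True, of c u] by (simp add: D_def k_def)
    next
      case False
      have "1 + min_pair_sum a (n - 1) + min_pair_sum b (c - 1) \<le> a n"
        using x_final_ge[of u 1 "n - 1" "replicate (10 * N - l) 1 @ replicate c 2 @ replicate (3 * N) 1 @ replicate (2 * c) 2" 2]
          False less.prems cu cw l unfolding a_def b_def w_u[symmetric] by simp
      moreover have "D * real (n + 1) - 2 * k \<le> real (min_pair_sum a (n - 1))"
      proof (rule min_pair_sum_ge)
        fix i j
        assume ij: "i + j = n - 1"
        then have n: "n = i + j + 1"
          using False l by simp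
        show "D * real (n + 1) - 2 * k \<le> real (a i) + real (a j)"
          using less.IH[of i] less.IH[of j] less.prems unfolding n by (simp add: algebra_simps)
      qed
      ultimately show ?thesis
        using k by linarith
    qed
  qed
  have mps_a: "D * real (n + 2) - 2 * k \<le> real (min_pair_sum a n)" if "n < 13 * N" for n
  proof (rule min_pair_sum_ge)
    fix i j
    assume "i + j = n"
    then show "D * real (n + 2) - 2 * k \<le> real (a i) + real (a j)"
      using a_lin[of i] a_lin[of j] that by (auto simp: algebra_simps)
  qed

  have "0 < N"
    using N l by simp
  txt \<open>
    In units of \<open>U\<close>, the \<open>c\<close> entries of \<open>b\<close> in each block are at least \<open>0\<close>, \<open>10\<close>, \<open>23\<close>, \<open>33\<close>, as in the
    simulated word.
  \<close>
  have b1: "10 * U - 2 * k \<le> real (b n)" if "c \<le> n" "n < 4 * c" for n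
  proof -
    have "1 + min_pair_sum b (c - 1) + min_pair_sum a (10 * N - 1) \<le> b c"
      using x_final_ge[of pre1 2 "c - 1" "replicate c 2 @ replicate (3 * N) 1 @ replicate (2 * c) 2" 1]
        c c1 cw unfolding a_def b_def w1[symmetric] by simp
    moreover have "10 * U - 2 * k \<le> real (min_pair_sum a (10 * N - 1))"
    proof -
      have "10 * N - 1 < 13 * N"
        using \<open>0 < N\<close> by simp
      then show ?thesis
        using mps_a[of "10 * N - 1"] \<open>0 < N\<close> D(1) by (simp add: U_def algebra_simps)
    qed
    moreover have "b c \<le> b n"
      using that by (rule b_mono)
    ultimately show ?thesis
      by linarith
  qed
  have mps_b1: "10 * U - 2 * k \<le> real (min_pair_sum b n)" if "2 * c - 1 \<le> n" "n < 4 * c" for n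
  proof (rule min_pair_sum_ge)
    fix i j
    assume "i + j = n"
    then have "c \<le> i \<and> i < 4 * c \<or> c \<le> j \<and> j < 4 * c"
      using that c by linarith
    then show "10 * U - 2 * k \<le> real (b i) + real (b j)"
      using b1[of i] b1[of j] by auto
  qed
  have b2: "23 * U - 4 * k \<le> real (b n)"
    and b2': "13 * U - 2 * k + real (min_pair_sum b (n - 1)) \<le> real (b n)"
    if "2 * c \<le> n" "n < 4 * c" for n
  proof -
    have "1 + min_pair_sum b (n - 1) + min_pair_sum a (13 * N - 1) \<le> b n"
      using x_final_ge[of pre3 2 "n - 1" "replicate (2 * c) 2" 1]
        c c3 cw that unfolding a_def b_def w_def[symmetric] by simp
    moreover have "13 * U - 2 * k \<le> real (min_pair_sum a (13 * N - 1))"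
    proof -
      have "13 * N - 1 < 13 * N"
        using \<open>0 < N\<close> by simp
      then show ?thesis
        using mps_a[of "13 * N - 1"] \<open>0 < N\<close> D(1) by (simp add: U_def algebra_simps)
    qed
    ultimately show *: "13 * U - 2 * k + real (min_pair_sum b (n - 1)) \<le> real (b n)"
      by linarith
    show "23 * U - 4 * k \<le> real (b n)"
    proof -
      have "2 * c - 1 \<le> n - 1" "n - 1 < 4 * c"
        using that by auto
      then show ?thesis
        using * mps_b1[of "n - 1"] by linarith
    qed
  qed
  have k0: "0 \<le> k"
    by (simp add: k_def)
  have b3: "33 * U - 6 * k \<le> real (b n)" if n: "3 * c \<le> n" "n < 4 * c" for n
  proof -
    have "20 * U - 4 * k \<le> real (min_pair_sum b (n - 1))"
    proof (rule min_pair_sum_ge)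
      fix i j
      assume ij: "i + j = n - 1"
      then have lt: "i < 4 * c" "j < 4 * c"
        using n by auto
      consider "2 * c \<le> i" | "2 * c \<le> j" | "c \<le> i" "c \<le> j"
        using ij n c by linarith
      then show "20 * U - 4 * k \<le> real (b i) + real (b j)"
        using b1[of i] b1[of j] b2[of i] b2[of j] lt U by cases simp_all
    qed
    then show ?thesis
      using b2'[of n] that by simp
  qed
  have beta_w: "33 * U - 6 * k \<le> real (beta (4 * c) w)"
  proof -
    have "33 * U - 6 * k \<le> real (min_pair_sum b (4 * c - 1))"
    proof (rule min_pair_sum_ge)
      fix i j
      assume ij: "i + j = 4 * c - 1"
      then have lt: "i < 4 * c" "j < 4 * c"
        using c by auto
      \<comment> \<open>If neither index reaches the last block, both are at least \<open>c\<close>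
        and one is at least \<open>2 * c\<close>, giving \<open>10 + 23 = 33\<close>.\<close>
      consider "3 * c \<le> i" | "3 * c \<le> j" | "2 * c \<le> i" "c \<le> j" | "2 * c \<le> j" "c \<le> i"
        using ij c by linarith
      then show "33 * U - 6 * k \<le> real (b i) + real (b j)"
        using b1[of i] b1[of j] b2[of i] b2[of j] b3[of i] b3[of j] lt by cases simp_all
    qed
    then show ?thesis
      by (simp add: beta_def b_def)
  qed
  \<comment> \<open>These entries come after the first new block of entries \<open>2\<close>, whose
    pair sum adds \<open>10 * U\<close>.\<close>
  have a2: "D * real (n + 1) + 10 * U - 4 * k \<le> real (a n)" if "10 * N \<le> n" "n < 13 * N" for n
  proof -
    have "1 + min_pair_sum a (n - 1) + min_pair_sum b (2 * c - 1) \<le> a n"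
      using x_final_ge[of pre2 1 "n - 1" "replicate (3 * N) 1 @ replicate (2 * c) 2" 2]
        c2 cw that \<open>0 < N\<close> unfolding a_def b_def w2[symmetric] by simp
    moreover have "D * real (n + 1) - 2 * k \<le> real (min_pair_sum a (n - 1))"
      using mps_a[of "n - 1"] that \<open>0 < N\<close> by (simp add: algebra_simps)
    moreover have "10 * U - 2 * k \<le> real (min_pair_sum b (2 * c - 1))"
      using c by (intro mps_b1) auto
    ultimately show ?thesis
      by linarith
  qed

  have "r \<le> delta_word (13 * N) (4 * c) w"
  proof (rule delta_word_ge)
    fix j
    assume j: "j < 13 * N"
    define t where "t = real (j + 1)"
    have "r * t \<le> r' * t"
      using D(3) by (intro mult_right_mono) (simp_all add: t_def)
    also have "\<dots> = D * t + (r' - D) * t"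
      by (simp add: algebra_simps)
    also have "\<dots> \<le> real (a j) + real (beta (4 * c) w)"
    \<comment> \<open>With \<open>r' = 43 / 10 * D - e\<close>, the first range needs exactly
      \<open>33 * U\<close>; the second needs \<open>429 / 10 * U\<close> and has
      \<open>43 * U\<close>. The slack from \<open>e\<close> covers errors of \<open>7 * k\<close>
      and \<open>10 * k\<close>.\<close>
    proof (cases "j < 10 * N")
      case True
      have "(r' - D) * t \<le> (r' - D) * (10 * real N)"
        using True D by (intro mult_left_mono) (auto simp: t_def)
      also have "\<dots> = 33 * U - 10 * (real N * e)"
        by (simp add: e_def U_def algebra_simps)
      finally show ?thesis
        using a_lin[OF j] beta_w N(2) k0 unfolding t_def[symmetric] by linarith
    next
      case False
      have "(r' - D) * t \<le> (r' - D) * (13 * real N)"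
        using j D by (intro mult_left_mono) (auto simp: t_def)
      also have "\<dots> = 429 / 10 * U - 13 * (real N * e)"
        by (simp add: e_def U_def algebra_simps)
      finally show ?thesis
        using a2[OF _ j] False beta_w N(2) k0 U unfolding t_def[symmetric] not_less by linarith
    qed
    finally show "r * real (j + 1) \<le> real (x_final w 1 j) + real (beta (4 * c) w)"
      by (simp add: t_def a_def)
  qed (use \<open>0 < N\<close> in simp)
  moreover have "w \<in> words (13 * N) (4 * c)"
    using u cw N l c by (auto simp: words_def w_u)
  moreover have "last w = 2"
    using c by (simp add: w_def)
  ultimately show ?thesis
    using \<open>0 < N\<close> by (intro exI[of _ "13 * N"] exI[of _ w]) auto
qed

text \<open>A final \<open>2\<close> keeps the first sequence and cannot lower \<open>beta\<close>;
  this fills the gaps between powers of 4.\<close>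

lemma delta_word_append_2:
  assumes "\<alpha> \<in> words l c" "1 \<le> l" "1 \<le> c"
  shows "\<alpha> @ [2] \<in> words l (Suc c)" "delta_word l c \<alpha> \<le> delta_word l (Suc c) (\<alpha> @ [2])"
proof -
  have cnt: "count_list \<alpha> 1 = l - 1" "count_list \<alpha> 2 = c - 1"
    using assms(1) by (auto simp: words_def)
  show "\<alpha> @ [2] \<in> words l (Suc c)"
    using assms by (auto simp: words_def)
  have "min_pair_sum (x_final (\<alpha> @ [2]) 2) (c - 1) \<le> min_pair_sum (x_final (\<alpha> @ [2]) 2) c"
    using cnt assms by (intro min_pair_sum_x_final_mono) auto
  then have "beta c \<alpha> \<le> beta (Suc c) (\<alpha> @ [2])"
    using cnt by (simp add: beta_def min_pair_sum_append)
  moreover have "x_final (\<alpha> @ [2]) 1 j = x_final \<alpha> 1 j" if "j < l" for j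
    using that cnt by (intro x_final_append) auto
  ultimately show "delta_word l c \<alpha> \<le> delta_word l (Suc c) (\<alpha> @ [2])"
    using assms(2) delta_word_mult_le[of _ l c \<alpha>]
    by (intro delta_word_ge) (simp, smt (verit) of_nat_mono)
qed

text \<open>Iterates the quadrupling from the empty word, whose value is 1. That word has no last
  letter, hence the condition \<open>i \<noteq> 0\<close>.\<close>

lemma words_large_delta:
  assumes "r < (43 / 10) ^ i"
  shows "\<exists>l w. 1 \<le> l \<and> w \<in> words l (4 ^ i) \<and> (i \<noteq> 0 \<longrightarrow> last w = 2) \<and> r \<le> delta_word l (4 ^ i) w"
  using assms
proof (induction i arbitrary: r)
  case 0
  have "[] \<in> words 1 1" "delta_word 1 1 [] = 1"
    by (auto simp: words_def delta_word_def x_final_Nil beta_def)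
  then show ?case
    using 0 by (intro exI[of _ 1] exI[of _ "[]"]) auto
next
  case (Suc i)
  then have "r / (43 / 10) < (43 / 10) ^ i"
    by simp
  \<comment> \<open>The intermediate \<open>r'\<close> supplies the strict inequality that
    \<open>delta_word_quadruple\<close> requires.\<close>
  then obtain r' where r': "r / (43 / 10) < r'" "r' < (43 / 10) ^ i"
    using dense by blast
  then obtain l w where w: "1 \<le> l" "w \<in> words l (4 ^ i)" "r' \<le> delta_word l (4 ^ i) w"
    using Suc.IH by blast
  have "r < 43 / 10 * delta_word l (4 ^ i) w"
    using r' w(3) by simp
  then show ?case
    using delta_word_quadruple[OF w(2,1)] by (metis one_le_numeral one_le_power power_Suc)
qed

lemma delta_ge:
  assumes "4 ^ i \<le> c" "i \<noteq> 0"
  shows "ereal ((43 / 10) ^ i) \<le> delta c"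
proof (rule ccontr)
  assume "\<not> ?thesis"
  \<comment> \<open>The constructed words only reach values below the power, so a real
    \<open>r\<close> strictly between is refuted.\<close>
  then obtain r where r: "delta c < ereal r" "ereal r < ereal ((43 / 10) ^ i)"
    using ereal_dense2 by (metis not_le)
  have "\<exists>l w. 1 \<le> l \<and> w \<in> words l c \<and> last w = 2 \<and> r \<le> delta_word l c w"
    using assms(1)
  proof (induction c rule: dec_induct)
    case base
    then show ?case
      using words_large_delta[of r i] r(2) assms(2) by auto
  next
    case (step n)
    have "1 \<le> n"
      using step.hyps(1) by (meson le_trans one_le_numeral one_le_power)
    obtain l w where w: "1 \<le> l" "w \<in> words l n" "r \<le> delta_word l n w"
      using step.IH by auto
    then show ?case
      using delta_word_append_2[OF w(2,1) \<open>1 \<le> n\<close>]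
      by (intro exI[of _ l] exI[of _ "w @ [2]"]) auto
  qed
  then obtain l w where w: "1 \<le> l" "w \<in> words l c" "last w = 2" "r \<le> delta_word l c w"
    by auto
  have "4 ^ 1 \<le> (4 :: nat) ^ i"
    using assms(2) by (intro power_increasing) auto
  then have "c \<noteq> 1"
    using assms(1) by simp
  then have "ereal (delta_word l c w) \<le> delta c"
    using w unfolding delta_def by (auto intro!: Sup_upper)
  with w(4) r(1) show False
    by (metis ereal_less_eq(3) leD le_less_trans)
qed

section \<open>Numerical exponents and passage to powers of \<open>c\<close>\<close>

lemma three_le_two_powr: "(3 :: real) \<le> 2 powr 1.59"
proof (rule power_le_imp_le_base)
  have "(2 powr 1.59) ^ Suc 99 = (2 :: real) powr 159"
    by (subst powr_realpow[symmetric]) (simp_all add: powr_powr)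
  \<comment> \<open>The integer inequality \<open>3 ^ 100 \<le> 2 ^ 159\<close>.\<close>
  then show "(3 :: real) ^ Suc 99 \<le> (2 powr 1.59) ^ Suc 99"
    by simp
qed simp

lemma four_powr_le: "(4 :: real) powr 1.05 \<le> 43 / 10"
proof (rule power_le_imp_le_base)
  have "(4 powr 1.05) ^ Suc 19 = (4 :: real) powr 21"
    by (subst powr_realpow[symmetric]) (simp_all add: powr_powr)
  then show "((4 :: real) powr 1.05) ^ Suc 19 \<le> (43 / 10) ^ Suc 19"
    by (simp add: power_divide)
qed simp

lemma power_powr_commute:
  fixes x y :: real
  assumes "0 < x"
  shows "(x ^ n) powr y = (x powr y) ^ n"
proof -
  have "(x ^ n) powr y = (x powr real n) powr y"
    using assms by (simp add: powr_realpow)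
  also have "\<dots> = (x powr y) powr real n"
    by (simp add: powr_powr mult.commute)
  also have "\<dots> = (x powr y) ^ n"
    using assms by (intro powr_realpow) simp
  finally show ?thesis .
qed

lemma delta_le_powr:
  assumes "1 \<le> c"
  shows "delta c \<le> ereal (real c powr 1.59)"
proof -
  obtain i where i: "2 ^ i \<le> c" "c < 2 ^ (i + 1)"
    using ex_power_ivl1[of 2 c] assms by auto
  have "(3 :: real) ^ i \<le> (2 powr 1.59) ^ i"
    by (intro power_mono three_le_two_powr) simp
  also have "\<dots> = (2 ^ i) powr 1.59"
    by (simp add: power_powr_commute)
  also have "\<dots> \<le> real c powr 1.59"
    using of_nat_mono[OF i(1), where ?'a = real] by (intro powr_mono2) auto
  finally have "ereal (3 ^ i) \<le> ereal (real c powr 1.59)"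
    by (simp only: ereal_less_eq)
  with delta_le[OF assms, of i] i(2) show ?thesis
    by (auto intro: order_trans)
qed

lemma delta_ge_powr:
  assumes "4 \<le> c"
  shows "ereal (10 / 43 * real c powr 1.05) \<le> delta c"
proof -
  obtain i where i: "4 ^ i \<le> c" "c < 4 ^ (i + 1)"
    using ex_power_ivl1[of 4 c] assms by auto
  have "i \<noteq> 0"
    using i(2) assms by (cases i) auto
  have "real c powr 1.05 \<le> (4 ^ (i + 1)) powr 1.05"
    using of_nat_mono[OF less_imp_le[OF i(2)], where ?'a = real] by (intro powr_mono2) auto
  also have "\<dots> = (4 powr 1.05) ^ (i + 1)"
    by (rule power_powr_commute) simp
  also have "\<dots> \<le> (43 / 10) ^ (i + 1)"
    by (intro power_mono four_powr_le) simp
  \<comment> \<open>The constant \<open>10 / 43\<close> pays for rounding \<open>c\<close> down to a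
    power of 4.\<close>
  finally have "10 / 43 * real c powr 1.05 \<le> (43 / 10) ^ i"
    by simp
  then have "ereal (10 / 43 * real c powr 1.05) \<le> ereal ((43 / 10) ^ i)"
    by (simp only: ereal_less_eq)
  then show ?thesis
    using delta_ge[OF i(1) \<open>i \<noteq> 0\<close>] by (rule order_trans)
qed

theorem theorem7:
  shows "(\<forall>\<^sub>F c in sequentially. \<bar>delta c\<bar> \<noteq> \<infinity>) \<and>
         (\<lambda>c::nat. real_of_ereal (delta c)) \<in> \<Omega>(\<lambda>c. real c powr 1.05) \<and>
         (\<lambda>c::nat. real_of_ereal (delta c)) \<in> O(\<lambda>c. real c powr 1.59)"
proof -
  \<comment> \<open>The extended real bounds on both sides give finiteness, so
    \<open>real_of_ereal\<close> does not fall back to its default 0.\<close>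
  have finite: "\<bar>delta c\<bar> \<noteq> \<infinity>"
    and lower: "10 / 43 * real c powr 1.05 \<le> real_of_ereal (delta c)"
    and upper: "real_of_ereal (delta c) \<le> real c powr 1.59" if "4 \<le> c" for c
    using delta_le_powr[of c] delta_ge_powr[of c] that by (cases "delta c"; simp)+
  have nonneg: "0 \<le> real_of_ereal (delta c)" if "4 \<le> c" for c
    by (rule order_trans[OF _ lower[OF that]]) simp
  have norm: "norm (real_of_ereal (delta c)) = real_of_ereal (delta c)" if "4 \<le> c" for c
    unfolding real_norm_def by (rule abs_of_nonneg[OF nonneg[OF that]])
  have ev: "\<forall>\<^sub>F c :: nat in sequentially. 4 \<le> c"
    by (rule eventually_ge_at_top)
  have "\<forall>\<^sub>F c in sequentially. \<bar>delta c\<bar> \<noteq> \<infinity>"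
    by (rule eventually_mono[OF ev finite])
  moreover have "(\<lambda>c::nat. real_of_ereal (delta c)) \<in> \<Omega>(\<lambda>c. real c powr 1.05)"
  proof (rule landau_omega.bigI[of "10 / 43"])
    show "\<forall>\<^sub>F c in sequentially. 10 / 43 * norm (real c powr 1.05) \<le> norm (real_of_ereal (delta c))"
    proof (rule eventually_mono[OF ev])
      fix c :: nat
      assume c: "4 \<le> c"
      show "10 / 43 * norm (real c powr 1.05) \<le> norm (real_of_ereal (delta c))"
        unfolding norm[OF c] using lower[OF c] by simp
    qed
  qed simp
  moreover have "(\<lambda>c::nat. real_of_ereal (delta c)) \<in> O(\<lambda>c. real c powr 1.59)"
  proof (rule landau_o.bigI[of 1])
    show "\<forall>\<^sub>F c in sequentially. norm (real_of_ereal (delta c)) \<le> 1 * norm (real c powr 1.59)"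
    proof (rule eventually_mono[OF ev])
      fix c :: nat
      assume c: "4 \<le> c"
      show "norm (real_of_ereal (delta c)) \<le> 1 * norm (real c powr 1.59)"
        unfolding norm[OF c] using upper[OF c] by simp
    qed
  qed simp
  ultimately show ?thesis
    by blast
qed

end
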